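(* Let $\Omega\subset\mathbb{H}$ be a symmetric slice domain. For any $f,g\in\mathcal{S}(\Omega)$ and any orthonormal basis $i,j,k$ of $\mathrm{Im}\,\mathbb{H}$, we have $$\mathcal{H}_{*}(f,g)=\langle f,g \rangle_*+\langle f,i*g \rangle_*\, i+\langle f, j*g\rangle_*\, j+\langle f,k*g \rangle_*\, k .$$
   Context: $\mathbb{H}$ is the algebra of quaternions, with standard basis $1,e_1,e_2,e_3$ ($e_1^2=e_2^2=e_3^2=-1$, $e_1e_2=-e_2e_1=e_3$), $\mathrm{Im}\,\mathbb{H}=\mathrm{Span}_{\mathbb{R}}(e_1,e_2,e_3)\simeq\mathbb{R}^3$ with its Euclidean structure, $\mathbb{S}=\{q\in\mathbb{H}: q^2=-1\}$, and $\mathbb{C}_I=\mathrm{Span}_{\mathbb{R}}(1,I)$ for $I\in\mathbb{S}$. A symmetric slice domain $\Omega\subset\mathbb{H}$ is a domain (connected open set) such that $\Omega\cap\mathbb{R}\neq\emptyset$ and, whenever $\alpha+I\beta\in\Omega$ ($\alpha,\beta\in\mathbb{R}$, $I\in\mathbb{S}$), also $\alpha+J\beta\in\Omega$ for all $J\in\mathbb{S}$. A function $f:\Omega\to\mathbb{H}$ is slice regular if for every $J\in\mathbb{S}$ the restriction $f_J$ of $f$ to $\Omega\cap\mathbb{C}_J$ is holomorphic: $\frac12\left(\frac{\partial}{\partial\alpha}+J\frac{\partial}{\partial\beta}\right)f_J(\alpha+J\beta)\equiv0$. $\mathcal{S}(\Omega)$ is the set of slice regular functions on $\Omega$ and $\mathcal{S}_{\mathbb{R}}(\Omega)$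 the subset of slice preserving ones, i.e. those with $f(\Omega\cap\mathbb{C}_I)\subset\mathbb{C}_I$ for all $I\in\mathbb{S}$. Known fact: every $f\in\mathcal{S}(\Omega)$ is written uniquely as $f=f_0+f_1e_1+f_2e_2+f_3e_3$ with $f_0,\dots,f_3\in\mathcal{S}_{\mathbb{R}}(\Omega)$. The regular conjugate is $f^c=f_0-f_1e_1-f_2e_2-f_3e_3$; the real part of $f$ is $f_0=\frac{f+f^c}{2}$, also written $(f)_0$. The $*$-product is $f*g=f_0g_0-f_1g_1-f_2g_2-f_3g_3+f_0(g_1e_1+g_2e_2+g_3e_3)+g_0(f_1e_1+f_2e_2+f_3e_3)+(f_2g_3-f_3g_2)e_1+(f_3g_1-f_1g_3)e_2+(f_1g_2-f_2g_1)e_3$ (pointwise products on the right-hand side). Quaternions are regarded as constant slice regular functions. $\langle f,g\rangle_*:=(f*g^c)_0$ and $\mathcal{H}_*(f,g):=f*g^c$. *)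

theory Defs
  imports "HOL-Analysis.Analysis"
begin

codatatype quat = Quat (q0: real) (q1: real) (q2: real) (q3: real)

lemma quat_eq_iff: "x = y \<longleftrightarrow> q0 x = q0 y \<and> q1 x = q1 y \<and> q2 x = q2 y \<and> q3 x = q3 y"
  by (auto intro: quat.expand)

lemma quat_eqI: "q0 x = q0 y \<Longrightarrow> q1 x = q1 y \<Longrightarrow> q2 x = q2 y \<Longrightarrow> q3 x = q3 y \<Longrightarrow> x = y"
  by (simp add: quat_eq_iff)

instantiation quat :: ring_1
begin

primcorec zero_quat where
  "q0 0 = 0" | "q1 0 = 0" | "q2 0 = 0" | "q3 0 = 0"

primcorec one_quat where
  "q0 1 = 1" | "q1 1 = 0" | "q2 1 = 0" | "q3 1 = 0"

primcorec plus_quat where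
  "q0 (x + y) = q0 x + q0 y"
| "q1 (x + y) = q1 x + q1 y"
| "q2 (x + y) = q2 x + q2 y"
| "q3 (x + y) = q3 x + q3 y"

primcorec uminus_quat where
  "q0 (- x) = - q0 x"
| "q1 (- x) = - q1 x"
| "q2 (- x) = - q2 x"
| "q3 (- x) = - q3 x"

primcorec minus_quat where
  "q0 (x - y) = q0 x - q0 y"
| "q1 (x - y) = q1 x - q1 y"
| "q2 (x - y) = q2 x - q2 y"
| "q3 (x - y) = q3 x - q3 y"

primcorec times_quat where
  "q0 (x * y) = q0 x * q0 y - q1 x * q1 y - q2 x * q2 y - q3 x * q3 y"
| "q1 (x * y) = q0 x * q1 y + q1 x * q0 y + q2 x * q3 y - q3 x * q2 y"
| "q2 (x * y) = q0 x * q2 y - q1 x * q3 y + q2 x * q0 y + q3 x * q1 y"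
| "q3 (x * y) = q0 x * q3 y + q1 x * q2 y - q2 x * q1 y + q3 x * q0 y"

instance
  by intro_classes (simp_all add: quat_eq_iff algebra_simps)

end

instantiation quat :: real_vector
begin

primcorec scaleR_quat where
  "q0 (scaleR r x) = r * q0 x"
| "q1 (scaleR r x) = r * q1 x"
| "q2 (scaleR r x) = r * q2 x"
| "q3 (scaleR r x) = r * q3 x"

instance
  by intro_classes (simp_all add: quat_eq_iff algebra_simps)

end

instantiation quat :: real_normed_vector
begin

definition norm_quat_def: "norm (x::quat) = sqrt ((q0 x)\<^sup>2 + (q1 x)\<^sup>2 + (q2 x)\<^sup>2 + (q3 x)\<^sup>2)"

definition sgn_quat_def: "sgn (x::quat) = x /\<^sub>R norm x"

definition dist_quat_def: "dist (x::quat) y = norm (x - y)"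

definition uniformity_quat_def: "(uniformity :: (quat \<times> quat) filter) = (INF e\<in>{0<..}. principal {(x, y). dist x y < e})"

definition open_quat_def: "open (U::quat set) \<longleftrightarrow> (\<forall>x\<in>U. eventually (\<lambda>(x', y). x' = x \<longrightarrow> y \<in> U) uniformity)"

instance
proof
  fix x y :: quat and a :: real
  have norm_eq: "norm z = norm ((q0 z, q1 z), (q2 z, q3 z))" for z
    by (simp add: norm_quat_def norm_Pair add.assoc)
  show "norm x = 0 \<longleftrightarrow> x = 0"
    by (auto simp: norm_eq quat_eq_iff prod_eq_iff)
  show "norm (x + y) \<le> norm x + norm y"
    using norm_triangle_ineq[of "((q0 x, q1 x), (q2 x, q3 x))" "((q0 y, q1 y), (q2 y, q3 y))"]
    by (simp add: norm_eq)
  show "norm (a *\<^sub>R x) = \<bar>a\<bar> * norm x"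
    using norm_scaleR[of a "((q0 x, q1 x), (q2 x, q3 x))"]
    by (simp add: norm_eq)
qed (fact sgn_quat_def dist_quat_def uniformity_quat_def open_quat_def)+

end

instantiation quat :: real_inner
begin

definition inner_quat_def: "inner (x::quat) y = q0 x * q0 y + q1 x * q1 y + q2 x * q2 y + q3 x * q3 y"

instance
proof
  fix x y z :: quat and a :: real
  show "inner x y = inner y x" "inner (x + y) z = inner x z + inner y z"
    "inner (a *\<^sub>R x) y = a * inner x y" "0 \<le> inner x x"
    by (simp_all add: inner_quat_def algebra_simps)
  show norm_eq: "norm x = sqrt (inner x x)"
    by (simp add: inner_quat_def norm_quat_def power2_eq_square)
  then show "inner x x = 0 \<longleftrightarrow> x = 0"
    using norm_eq_zero[of x] by simp
qed

end

instantiation quat :: real_normed_div_algebra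
begin

definition inverse_quat_def: "inverse (x::quat) = Quat (q0 x) (- q1 x) (- q2 x) (- q3 x) /\<^sub>R inner x x"

definition divide_quat_def: "divide (x::quat) y = x * inverse y"

instance
proof
  fix x y :: quat and a :: real
  show "(a *\<^sub>R x) * y = a *\<^sub>R (x * y)" "x * a *\<^sub>R y = a *\<^sub>R (x * y)"
    by (simp_all add: quat_eq_iff algebra_simps)
  show "inverse x * x = 1" "x * inverse x = 1" if "x \<noteq> 0"
  proof -
    have nz: "inner x x \<noteq> 0" using that by simp
    let ?c = "Quat (q0 x) (- q1 x) (- q2 x) (- q3 x)"
    have A: "(a *\<^sub>R u) * v = a *\<^sub>R (u * v)" "u * a *\<^sub>R v = a *\<^sub>R (u * v)" for u v :: quat and a
      by (simp_all add: quat_eq_iff algebra_simps)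
    have "?c * x = inner x x *\<^sub>R 1" "x * ?c = inner x x *\<^sub>R 1"
      by (simp_all add: quat_eq_iff inner_quat_def)
    then show "inverse x * x = 1" "x * inverse x = 1"
      by (simp_all only: inverse_quat_def A scaleR_scaleR left_inverse[OF nz] scaleR_one)
  qed
  show "x div y = x * inverse y" by (fact divide_quat_def)
  show "inverse (0::quat) = 0" by (simp add: inverse_quat_def inner_quat_def)
  have "inner (x * y) (x * y) = inner x x * inner y y"
    by (simp add: inner_quat_def) algebra
  then show "norm (x * y) = norm x * norm y"
    by (simp add: norm_eq_sqrt_inner real_sqrt_mult)
qed

end

definition e1 :: quat where "e1 = Quat 0 1 0 0"
definition e2 :: quat where "e2 = Quat 0 0 1 0"
definition e3 :: quat where "e3 = Quat 0 0 0 1"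

lemma quat_basis_mult:
  "e1\<^sup>2 = -1" "e2\<^sup>2 = -1" "e3\<^sup>2 = -1" "e1 * e2 = e3" "e2 * e1 = - e3"
  by (simp_all add: e1_def e2_def e3_def quat_eq_iff power2_eq_square)

definition ImH :: "quat set" where
  "ImH = span {e1, e2, e3}"

definition orthonormal_basis_ImH :: "quat \<Rightarrow> quat \<Rightarrow> quat \<Rightarrow> bool" where
  "orthonormal_basis_ImH i j k \<longleftrightarrow>
     span {i, j, k} = ImH \<and>
     norm i = 1 \<and> norm j = 1 \<and> norm k = 1 \<and>
     inner i j = 0 \<and> inner i k = 0 \<and> inner j k = 0"

definition unit_sphere :: "quat set" ("\<S>") where
  "\<S> = {q. q\<^sup>2 = -1}"

definition slice_plane :: "quat \<Rightarrow> quat set" ("\<C>") where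
  "\<C> I = span {1, I}"

text \<open>\<open>slice_pt I z\<close> is \<open>\<alpha> + I \<beta>\<close> for \<open>z = \<alpha> + \<i> \<beta>\<close>.\<close>

definition slice_pt :: "quat \<Rightarrow> complex \<Rightarrow> quat" where
  "slice_pt I z = of_real (Re z) + I * of_real (Im z)"

definition symmetric_slice_domain :: "quat set \<Rightarrow> bool" where
  "symmetric_slice_domain \<Omega> \<longleftrightarrow>
     open \<Omega> \<and> connected \<Omega> \<and> \<Omega> \<inter> \<real> \<noteq> {} \<and>
     (\<forall>z. \<forall>I\<in>\<S>. slice_pt I z \<in> \<Omega> \<longrightarrow> (\<forall>J\<in>\<S>. slice_pt J z \<in> \<Omega>))"

text \<open>
  Functions on \<open>\<Omega>\<close> are total functions of which only the values on \<open>\<Omega>\<close> matter.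
  In the coordinate \<open>z = \<alpha> + \<i> \<beta>\<close> on the plane \<open>\<C> J\<close>, the partial derivatives with respect to
  \<open>\<alpha>\<close> and \<open>\<beta>\<close> are the values \<open>D 1\<close> and \<open>D \<i>\<close> of the real derivative.
\<close>

definition slice_regular :: "quat set \<Rightarrow> (quat \<Rightarrow> quat) \<Rightarrow> bool" where
  "slice_regular \<Omega> f \<longleftrightarrow>
     (\<forall>J\<in>\<S>. \<forall>z. slice_pt J z \<in> \<Omega> \<longrightarrow>
        (\<exists>D. ((\<lambda>w. f (slice_pt J w)) has_derivative D) (at z) \<and>
             (1/2) *\<^sub>R (D 1 + J * D \<i>) = 0))"

definition slice_preserving :: "quat set \<Rightarrow> (quat \<Rightarrow> quat) \<Rightarrow> bool" where
  "slice_preserving \<Omega> f \<longleftrightarrow>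
     slice_regular \<Omega> f \<and> (\<forall>I\<in>\<S>. f ` (\<Omega> \<inter> \<C> I) \<subseteq> \<C> I)"

text \<open>
  The components of the decomposition \<open>f = f\<^sub>0 + f\<^sub>1 e\<^sub>1 + f\<^sub>2 e\<^sub>2 + f\<^sub>3 e\<^sub>3\<close>. For slice regular \<open>f\<close> on a
  symmetric slice domain it exists and is unique on \<open>\<Omega>\<close>, so the choice only affects values off
  \<open>\<Omega>\<close> and indices above 3.
\<close>

definition slice_comp :: "quat set \<Rightarrow> (quat \<Rightarrow> quat) \<Rightarrow> nat \<Rightarrow> quat \<Rightarrow> quat" where
  "slice_comp \<Omega> f = (SOME F. (\<forall>l\<le>3. slice_preserving \<Omega> (F l)) \<and>
     (\<forall>q\<in>\<Omega>. f q = F 0 q + F 1 q * e1 + F 2 q * e2 + F 3 q * e3))"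

definition slice_real_part :: "quat set \<Rightarrow> (quat \<Rightarrow> quat) \<Rightarrow> quat \<Rightarrow> quat" where
  "slice_real_part \<Omega> f = slice_comp \<Omega> f 0"

definition regular_conj :: "quat set \<Rightarrow> (quat \<Rightarrow> quat) \<Rightarrow> quat \<Rightarrow> quat" where
  "regular_conj \<Omega> f = (\<lambda>q. slice_comp \<Omega> f 0 q - slice_comp \<Omega> f 1 q * e1
     - slice_comp \<Omega> f 2 q * e2 - slice_comp \<Omega> f 3 q * e3)"

definition star_prod :: "quat set \<Rightarrow> (quat \<Rightarrow> quat) \<Rightarrow> (quat \<Rightarrow> quat) \<Rightarrow> quat \<Rightarrow> quat" where
  "star_prod \<Omega> f g = (\<lambda>q.
     let f0 = slice_comp \<Omega> f 0 q; f1 = slice_comp \<Omega> f 1 q;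
         f2 = slice_comp \<Omega> f 2 q; f3 = slice_comp \<Omega> f 3 q;
         g0 = slice_comp \<Omega> g 0 q; g1 = slice_comp \<Omega> g 1 q;
         g2 = slice_comp \<Omega> g 2 q; g3 = slice_comp \<Omega> g 3 q
     in f0 * g0 - f1 * g1 - f2 * g2 - f3 * g3
        + f0 * (g1 * e1 + g2 * e2 + g3 * e3)
        + g0 * (f1 * e1 + f2 * e2 + f3 * e3)
        + (f2 * g3 - f3 * g2) * e1
        + (f3 * g1 - f1 * g3) * e2
        + (f1 * g2 - f2 * g1) * e3)"

definition star_inner :: "quat set \<Rightarrow> (quat \<Rightarrow> quat) \<Rightarrow> (quat \<Rightarrow> quat) \<Rightarrow> quat \<Rightarrow> quat" where
  "star_inner \<Omega> f g = slice_real_part \<Omega> (star_prod \<Omega> f (regular_conj \<Omega> g))"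

definition star_hermitian :: "quat set \<Rightarrow> (quat \<Rightarrow> quat) \<Rightarrow> (quat \<Rightarrow> quat) \<Rightarrow> quat \<Rightarrow> quat" where
  "star_hermitian \<Omega> f g = star_prod \<Omega> f (regular_conj \<Omega> g)"

end

(* By the representation formula, f(a + J b) = A(a + i b) + J B(a + i b) with stem parts A, B
   independent of J: both sides are J-holomorphic on the slice and agree on the real axis, and the
   slice is connected.  The real coordinates of A and B give the slice preserving components of f,
   and letting J vary shows that they are unique, so the components of conjugates and *-products can
   be read off the defining formulas.  The components commute pointwise, hence <f, u * g>_* is linear
   in an imaginary u, with <f, e_l * g>_* the l-th component of f * g^c; the claim follows from
   e_l = <e_l, i> i + <e_l, j> j + <e_l, k> k. *)

theory Submission
  imports Defs "HOL-Complex_Analysis.Complex_Analysis"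
begin

section \<open>Slices of the quaternions\<close>

lemma quat_components_of_real [simp]:
  "q0 (of_real r) = r" "q1 (of_real r) = 0" "q2 (of_real r) = 0" "q3 (of_real r) = 0"
  by (simp_all add: of_real_def)

lemma quat_components_basis [simp]:
  "q0 e1 = 0" "q1 e1 = 1" "q2 e1 = 0" "q3 e1 = 0"
  "q0 e2 = 0" "q1 e2 = 0" "q2 e2 = 1" "q3 e2 = 0"
  "q0 e3 = 0" "q1 e3 = 0" "q2 e3 = 0" "q3 e3 = 1"
  by (simp_all add: e1_def e2_def e3_def)

lemma quat_components_eq_inner:
  "q0 = (\<lambda>x. inner x 1)" "q1 = (\<lambda>x. inner x e1)" "q2 = (\<lambda>x. inner x e2)" "q3 = (\<lambda>x. inner x e3)"
  by (simp_all add: fun_eq_iff inner_quat_def)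

lemma bounded_linear_quat_components:
  "bounded_linear q0" "bounded_linear q1" "bounded_linear q2" "bounded_linear q3"
  by (simp_all add: quat_components_eq_inner bounded_linear_inner_left)

text \<open>The imaginary coordinates of J^2 are twice the real part times those of J. A nonzero
  real part would therefore force J to be real with square -1.\<close>

lemma unit_sphere_iff: "J \<in> \<S> \<longleftrightarrow> q0 J = 0 \<and> (q1 J)\<^sup>2 + (q2 J)\<^sup>2 + (q3 J)\<^sup>2 = 1"
proof
  assume "J \<in> \<S>"
  then have eq: "q0 J * q0 J - q1 J * q1 J - q2 J * q2 J - q3 J * q3 J = -1"
    "q0 J * q1 J = 0" "q0 J * q2 J = 0" "q0 J * q3 J = 0"
    by (auto simp: unit_sphere_def quat_eq_iff power2_eq_square)
  have "q0 J = 0"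
  proof (rule ccontr)
    assume "q0 J \<noteq> 0"
    with eq have "q0 J * q0 J = -1" by simp
    then show False using zero_le_square[of "q0 J"] by linarith
  qed
  with eq show "q0 J = 0 \<and> (q1 J)\<^sup>2 + (q2 J)\<^sup>2 + (q3 J)\<^sup>2 = 1"
    by (simp add: power2_eq_square)
qed (auto simp: unit_sphere_def quat_eq_iff power2_eq_square)

lemma unit_sphere_square: "J \<in> \<S> \<Longrightarrow> J * J = -1"
  by (simp add: unit_sphere_def power2_eq_square)

lemma unit_sphere_uminus: "J \<in> \<S> \<Longrightarrow> - J \<in> \<S>"
  by (simp add: unit_sphere_iff)

lemma unit_sphere_norm: "J \<in> \<S> \<Longrightarrow> norm J = 1"
  by (simp add: unit_sphere_iff norm_quat_def)

lemma basis_in_unit_sphere: "e1 \<in> \<S>" "e2 \<in> \<S>" "e3 \<in> \<S>"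
  by (simp_all add: unit_sphere_iff)

lemma unit_sphere_left_cancel: "J \<in> \<S> \<Longrightarrow> J * (J * x) = - x"
  by (simp add: unit_sphere_square flip: mult.assoc)

lemma slice_pt_cnj: "slice_pt J (cnj z) = slice_pt (- J) z"
  by (simp add: slice_pt_def)

lemma slice_pt_scaleR: "slice_pt J z = Re z *\<^sub>R 1 + Im z *\<^sub>R J"
  by (simp add: slice_pt_def quat_eq_iff)

lemma slice_pt_in_slice_plane: "slice_pt J z \<in> \<C> J"
  unfolding slice_plane_def slice_pt_scaleR by (intro span_add span_scale span_base) simp_all

lemma slice_plane_eq_range: "\<C> J = range (slice_pt J)"
proof
  show "\<C> J \<subseteq> range (slice_pt J)"
  proof
    fix x assume "x \<in> \<C> J"
    then obtain a b where "x - a *\<^sub>R 1 = b *\<^sub>R J"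
      by (auto simp: slice_plane_def span_insert)
    then have "x = slice_pt J (Complex a b)"
      by (simp add: slice_pt_scaleR algebra_simps)
    then show "x \<in> range (slice_pt J)" by blast
  qed
qed (use slice_pt_in_slice_plane in blast)

lemma slice_plane_closed:
  assumes "x \<in> \<C> J" "y \<in> \<C> J"
  shows "x + y \<in> \<C> J" "x - y \<in> \<C> J" "- x \<in> \<C> J" "r *\<^sub>R x \<in> \<C> J"
  using assms by (simp_all add: slice_plane_def span_add span_diff span_neg span_scale)

lemma slice_plane_mult:
  assumes "J \<in> \<S>" "x \<in> \<C> J" "y \<in> \<C> J"
  shows "x * y \<in> \<C> J"
proof -
  obtain z w where "x = slice_pt J z" "y = slice_pt J w"
    using assms by (auto simp: slice_plane_eq_range)
  then have "x * y = slice_pt J (z * w)"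
    using unit_sphere_square[OF assms(1)] by (simp add: slice_pt_scaleR algebra_simps)
  then show ?thesis by (simp add: slice_plane_eq_range)
qed

text \<open>Both factors are real combinations of 1 and J. All commutation of slice preserving
  values rests on this.\<close>

lemma slice_plane_commute:
  assumes "x \<in> \<C> J" "y \<in> \<C> J"
  shows "x * y = y * x"
proof -
  obtain z w where "x = slice_pt J z" "y = slice_pt J w"
    using assms by (auto simp: slice_plane_eq_range)
  then show ?thesis
    by (simp add: slice_pt_def quat_eq_iff algebra_simps)
qed

lemma of_real_in_slice_plane: "of_real r \<in> \<C> J"
  by (simp add: slice_plane_def of_real_def span_scale span_base)

lemma unit_in_slice_plane: "J \<in> \<C> J"
  by (simp add: slice_plane_def span_base)

text \<open>Already the planes of \<open>e1\<close> and \<open>e2\<close> meet in the real axis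
  only.\<close>

lemma slice_planes_Int_real:
  assumes "\<And>J. J \<in> \<S> \<Longrightarrow> x \<in> \<C> J"
  shows "x = of_real (q0 x)"
proof -
  have "x \<in> range (slice_pt e1)" "x \<in> range (slice_pt e2)"
    using assms[OF basis_in_unit_sphere(1)] assms[OF basis_in_unit_sphere(2)]
    by (simp_all add: slice_plane_eq_range)
  then obtain z w where "x = slice_pt e1 z" "x = slice_pt e2 w" by blast
  then show ?thesis
    by (auto simp: slice_pt_def quat_eq_iff)
qed

section \<open>Coordinate and direction of a quaternion\<close>

definition quat_proj :: "quat \<Rightarrow> complex" where
  "quat_proj q = Complex (q0 q) (norm (q - of_real (q0 q)))"

text \<open>A real point has no distinguished direction; the arbitrary value \<open>e1\<close> is
  harmless because the imaginary coordinate is 0 there.\<close>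

definition quat_dir :: "quat \<Rightarrow> quat" where
  "quat_dir q = (if q = of_real (q0 q) then e1 else sgn (q - of_real (q0 q)))"

lemma quat_dir_in_unit_sphere: "quat_dir q \<in> \<S>"
proof (cases "q = of_real (q0 q)")
  case False
  then have "norm (sgn (q - of_real (q0 q))) = 1"
    by (simp add: norm_sgn)
  then show ?thesis using False
    by (simp add: quat_dir_def unit_sphere_iff norm_quat_def sgn_quat_def)
qed (simp add: quat_dir_def basis_in_unit_sphere)

lemma slice_pt_quat_proj: "slice_pt (quat_dir q) (quat_proj q) = q"
proof (cases "q = of_real (q0 q)")
  case True
  then show ?thesis by (simp add: slice_pt_def quat_proj_def)
next
  case False
  have "sgn x * of_real (norm x) = x" if "x \<noteq> 0" for x :: quat
    using that by (simp add: sgn_div_norm quat_eq_iff)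
  with False show ?thesis
    by (simp add: slice_pt_def quat_proj_def quat_dir_def)
qed

text \<open>The pairs J, z and -J, \<open>cnj z\<close> describe the same point, so the coordinate
  is determined only up to conjugation; \<open>quat_proj\<close> picks the closed upper half
  plane.\<close>

lemma quat_proj_slice_pt:
  assumes "J \<in> \<S>"
  shows "quat_proj (slice_pt J z) = Complex (Re z) \<bar>Im z\<bar>"
proof -
  have "norm (J * of_real (Im z)) = \<bar>Im z\<bar>"
    using assms by (simp add: norm_mult unit_sphere_norm)
  moreover have "q0 (slice_pt J z) = Re z"
    using assms by (simp add: slice_pt_def unit_sphere_iff)
  ultimately show ?thesis
    unfolding quat_proj_def by (metis (no_types) add_diff_cancel_left' slice_pt_def)
qed

lemma quat_dir_slice_pt:
  assumes "J \<in> \<S>" "Im z \<noteq> 0"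
  shows "quat_dir (slice_pt J z) = sgn (Im z) *\<^sub>R J"
proof -
  have 1: "q0 (slice_pt J z) = Re z"
    using assms by (simp add: slice_pt_def unit_sphere_iff)
  have "norm J = 1" using assms by (simp add: unit_sphere_norm)
  then have 2: "J \<noteq> 0" by auto
  have "slice_pt J z - of_real (Re z) = Im z *\<^sub>R J"
    by (simp add: slice_pt_scaleR of_real_def)
  moreover from this have "slice_pt J z \<noteq> of_real (Re z)" using 2 assms by auto
  ultimately show ?thesis using 1 \<open>norm J = 1\<close>
    by (simp add: quat_dir_def sgn_scaleR) (simp add: sgn_div_norm)
qed

lemma bounded_linear_slice_pt: "bounded_linear (slice_pt J)"
  unfolding slice_pt_scaleR[abs_def]
  by (intro bounded_linear_add bounded_linear_compose[OF bounded_linear_scaleR_left]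
        bounded_linear_Re bounded_linear_Im)

section \<open>The common coordinate domain of all slices\<close>

definition slice_dom :: "quat set \<Rightarrow> complex set" where
  "slice_dom \<Omega> = {z. slice_pt e1 z \<in> \<Omega>}"

text \<open>Symmetry of \<open>\<Omega>\<close> makes the plane of \<open>e1\<close> representative
  of every slice.\<close>

lemma slice_dom_iff:
  assumes "symmetric_slice_domain \<Omega>" "J \<in> \<S>"
  shows "slice_pt J z \<in> \<Omega> \<longleftrightarrow> z \<in> slice_dom \<Omega>"
  using assms basis_in_unit_sphere unfolding symmetric_slice_domain_def slice_dom_def by blast

lemma cnj_in_slice_dom:
  assumes "symmetric_slice_domain \<Omega>" "z \<in> slice_dom \<Omega>"
  shows "cnj z \<in> slice_dom \<Omega>"
  using assms slice_dom_iff[OF assms(1) unit_sphere_uminus[OF basis_in_unit_sphere(1)]]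
  by (simp add: slice_pt_cnj slice_dom_def)

lemma open_slice_dom:
  assumes "symmetric_slice_domain \<Omega>"
  shows "open (slice_dom \<Omega>)"
proof -
  have "open (slice_pt e1 -` \<Omega>)"
    using assms bounded_linear_slice_pt
    by (intro open_vimage) (auto simp: symmetric_slice_domain_def linear_continuous_on)
  then show ?thesis by (simp add: slice_dom_def vimage_def)
qed

lemma slice_dom_real_point:
  assumes "symmetric_slice_domain \<Omega>"
  obtains x where "complex_of_real x \<in> slice_dom \<Omega>"
proof -
  obtain x where "of_real x \<in> \<Omega>"
    using assms by (auto simp: symmetric_slice_domain_def Reals_def)
  then show ?thesis using that[of x] by (simp add: slice_dom_def slice_pt_def)
qed

text \<open>The continuous image of \<open>\<Omega>\<close> under \<open>quat_proj\<close> is the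
  closed upper half of the domain, its conjugate is the lower half, and the two connected halves
  share a real point.\<close>

lemma connected_slice_dom:
  assumes "symmetric_slice_domain \<Omega>"
  shows "connected (slice_dom \<Omega>)"
proof -
  let ?P = "quat_proj ` \<Omega>"
  have "continuous_on \<Omega> quat_proj"
    unfolding quat_proj_def Complex_eq
    by (intro continuous_intros linear_continuous_on bounded_linear_quat_components)
  then have P: "connected ?P"
    using assms by (intro connected_continuous_image) (auto simp: symmetric_slice_domain_def)
  have cP: "connected (cnj ` ?P)"
    by (intro connected_continuous_image P continuous_intros)
  have sub: "?P \<subseteq> slice_dom \<Omega>"
    using slice_dom_iff[OF assms quat_dir_in_unit_sphere]
    by (metis image_subsetI slice_pt_quat_proj)
  obtain x where x: "complex_of_real x \<in> slice_dom \<Omega>"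
    using slice_dom_real_point[OF assms] .
  have upper: "z \<in> ?P" if "z \<in> slice_dom \<Omega>" "Im z \<ge> 0" for z
  proof -
    have "quat_proj (slice_pt e1 z) = z"
      using that by (simp add: quat_proj_slice_pt basis_in_unit_sphere)
    then show ?thesis using that by (force simp: slice_dom_def)
  qed
  have "complex_of_real x \<in> ?P \<inter> cnj ` ?P"
    using upper[OF x] by (metis Im_complex_of_real IntI complex_cnj_complex_of_real image_eqI order_refl)
  then have "connected (?P \<union> cnj ` ?P)"
    using connected_Un[OF P cP] by blast
  moreover have "slice_dom \<Omega> = ?P \<union> cnj ` ?P"
  proof
    show "slice_dom \<Omega> \<subseteq> ?P \<union> cnj ` ?P"
    proof
      fix z assume z: "z \<in> slice_dom \<Omega>"
      show "z \<in> ?P \<union> cnj ` ?P"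
      proof (cases "Im z \<ge> 0")
        case False
        then have "cnj z \<in> ?P" using upper[OF cnj_in_slice_dom[OF assms z]] by simp
        then show ?thesis by (metis UnI2 complex_cnj_cnj image_eqI)
      qed (use upper z in blast)
    qed
    show "?P \<union> cnj ` ?P \<subseteq> slice_dom \<Omega>"
      using sub cnj_in_slice_dom[OF assms] by blast
  qed
  ultimately show ?thesis by simp
qed

section \<open>The representation formula\<close>

text \<open>Since J^2 = -1, the Cauchy-Riemann equation says that the derivative turns
  multiplication by \<open>\<i>\<close> into left multiplication by J.\<close>

lemma slice_regular_iff:
  assumes "symmetric_slice_domain \<Omega>"
  shows "slice_regular \<Omega> f \<longleftrightarrow> (\<forall>J\<in>\<S>. \<forall>z\<in>slice_dom \<Omega>.
    \<exists>D. ((\<lambda>w. f (slice_pt J w)) has_derivative D) (at z) \<and> D \<i> = J * D 1)"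
proof -
  have "(1/2) *\<^sub>R (x + J * y) = 0 \<longleftrightarrow> y = J * x" if "J \<in> \<S>" for J x y :: quat
  proof -
    have "(1/2) *\<^sub>R (x + J * y) = 0 \<longleftrightarrow> x = - (J * y)"
      by (simp add: eq_neg_iff_add_eq_0)
    also have "\<dots> \<longleftrightarrow> y = J * x"
      using unit_sphere_left_cancel[OF that] by (metis add.inverse_inverse mult_minus_right)
    finally show ?thesis .
  qed
  then show ?thesis
    unfolding slice_regular_def using slice_dom_iff[OF assms] by (metis (no_types, lifting))
qed

lemma slice_regularD:
  assumes "symmetric_slice_domain \<Omega>" "slice_regular \<Omega> f" "J \<in> \<S>" "z \<in> slice_dom \<Omega>"
  obtains D where "((\<lambda>w. f (slice_pt J w)) has_derivative D) (at z)" "D \<i> = J * D 1"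
  using assms slice_regular_iff by blast

section \<open>The identity theorem on a single slice\<close>

lemma inner_unit_mult:
  assumes "J \<in> \<S>"
  shows "inner (J * x) y = - inner x (J * y)" "inner (J * x) (J * y) = inner x y"
proof -
  show *: "inner (J * x) y = - inner x (J * y)" for x y
    using assms by (simp add: inner_quat_def unit_sphere_iff algebra_simps)
  show "inner (J * x) (J * y) = inner x y"
    using assms by (simp add: * unit_sphere_left_cancel)
qed

text \<open>
  For every quaternion \<open>v\<close>, the complex-valued function \<open>\<langle>F z, v\<rangle> + \<i> \<langle>F z, J v\<rangle>\<close> is holomorphic
  in the usual sense, so the complex identity theorem applies to it.
\<close>

lemma slice_identity_principle:
  fixes F :: "complex \<Rightarrow> quat"
  assumes U: "open U" "connected U" "of_real x \<in> U" and J: "J \<in> \<S>"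
    and F: "\<And>z. z \<in> U \<Longrightarrow> \<exists>D. (F has_derivative D) (at z) \<and> D \<i> = J * D 1"
    and real: "\<And>t. of_real t \<in> U \<Longrightarrow> F (of_real t) = 0"
    and z: "z \<in> U"
  shows "F z = 0"
proof -
  define \<phi> where "\<phi> v w = of_real (inner (F w) v) + \<i> * of_real (inner (F w) (J * v))" for v w
  have hol: "\<phi> v holomorphic_on U" for v
  proof (rule holomorphic_onI, rule field_differentiable_at_within)
    fix w assume "w \<in> U"
    then obtain D where D: "(F has_derivative D) (at w)" "D \<i> = J * D 1" using F by blast
    let ?E = "\<lambda>h. of_real (inner (D h) v) + \<i> * of_real (inner (D h) (J * v))"
    have E: "(\<phi> v has_derivative ?E) (at w)"
      unfolding \<phi>_def
      by (intro has_derivative_add has_derivative_mult_right has_derivative_of_real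
          has_derivative_inner_left D(1))
    have lin: "linear D" using D(1) has_derivative_linear by blast
    \<comment> \<open>Skewness and orthogonality of left multiplication by J make the real
      derivative complex linear.\<close>
    have E_mult: "?E h = ?E 1 * h" for h
    proof -
      have "D h = D (Re h *\<^sub>R 1 + Im h *\<^sub>R \<i>)"
        by (rule arg_cong[of _ _ D]) (simp add: complex_eq_iff)
      also have "\<dots> = Re h *\<^sub>R D 1 + Im h *\<^sub>R (J * D 1)"
        using lin by (simp only: linear_add linear_scale D(2))
      finally show ?thesis
        by (simp add: inner_unit_mult[OF J] unit_sphere_left_cancel[OF J] inner_add_left complex_eq_iff algebra_simps)
    qed
    have "?E = (*) (?E 1)" by (rule ext) (rule E_mult)
    with E show "\<phi> v field_differentiable at w"
      unfolding field_differentiable_def has_field_derivative_def by metis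
  qed
  \<comment> \<open>The real points \<open>x + min d e / 2\<close> differ from \<open>x\<close>,
    stay in the ball inside \<open>U\<close>, and come arbitrarily close to
    \<open>x\<close>.\<close>
  have islim: "complex_of_real x islimpt (U \<inter> \<real>)"
  proof -
    obtain e where e: "e > 0" "ball (complex_of_real x) e \<subseteq> U"
      using U open_contains_ball by blast
    show ?thesis
      unfolding islimpt_approachable
    proof (intro allI impI)
      fix d :: real assume "d > 0"
      define t where "t = x + min d e / 2"
      have "dist (complex_of_real t) (of_real x) = min d e / 2"
        unfolding dist_norm of_real_diff[symmetric] norm_of_real
        using \<open>d > 0\<close> e by (simp add: t_def)
      then show "\<exists>y\<in>U \<inter> \<real>. y \<noteq> complex_of_real x \<and> dist y (of_real x) < d"
        using \<open>d > 0\<close> e(1) e(2)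
        by (intro bexI[of _ "of_real t"]) (auto simp: dist_commute subset_iff t_def)
    qed
  qed
  have "\<phi> v z = 0" for v
    by (rule analytic_continuation[OF hol U(1,2) _ U(3) islim _ z])
      (auto simp: \<phi>_def real Reals_def)
  \<comment> \<open>For \<open>v = F z\<close> the real part of \<open>\<phi> v z\<close> is the
    squared norm of \<open>F z\<close>.\<close>
  from this[of "F z"] have "inner (F z) (F z) = 0"
    by (simp add: \<phi>_def complex_eq_iff)
  then show ?thesis by simp
qed

section \<open>Stem parts of a slice regular function\<close>

definition stem_re :: "(quat \<Rightarrow> quat) \<Rightarrow> complex \<Rightarrow> quat" where
  "stem_re f z = (1/2) *\<^sub>R (f (slice_pt e1 z) + f (slice_pt e1 (cnj z)))"

text \<open>The two stem parts solve f(z) = A + e1 B, f(cnj z) = A - e1 B on the slice of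
  \<open>e1\<close>. The difference is reversed because the inverse of \<open>e1\<close> is
  \<open>- e1\<close>.\<close>

definition stem_im :: "(quat \<Rightarrow> quat) \<Rightarrow> complex \<Rightarrow> quat" where
  "stem_im f z = (1/2) *\<^sub>R (e1 * (f (slice_pt e1 (cnj z)) - f (slice_pt e1 z)))"

lemma stem_cnj: "stem_re f (cnj z) = stem_re f z" "stem_im f (cnj z) = - stem_im f z"
  by (simp_all add: stem_re_def stem_im_def algebra_simps)

text \<open>These are the Cauchy-Riemann equations of the stem function A + iB. They follow from the
  equations for f at z and at \<open>cnj z\<close>, where conjugation turns \<open>\<i>\<close> into
  \<open>- \<i>\<close>.\<close>

lemma stem_derivatives:
  assumes \<Omega>: "symmetric_slice_domain \<Omega>" and f: "slice_regular \<Omega> f" and z: "z \<in> slice_dom \<Omega>"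
  obtains A B where "(stem_re f has_derivative A) (at z)" "(stem_im f has_derivative B) (at z)"
    "A \<i> = - B 1" "B \<i> = A 1"
proof -
  obtain D where D: "((\<lambda>w. f (slice_pt e1 w)) has_derivative D) (at z)" "D \<i> = e1 * D 1"
    using slice_regularD[OF \<Omega> f basis_in_unit_sphere(1) z] .
  obtain E where E: "((\<lambda>w. f (slice_pt e1 w)) has_derivative E) (at (cnj z))" "E \<i> = e1 * E 1"
    using slice_regularD[OF \<Omega> f basis_in_unit_sphere(1) cnj_in_slice_dom[OF \<Omega> z]] .
  have cnj: "(cnj has_derivative cnj) (at z)"
    by (rule bounded_linear_imp_has_derivative[OF bounded_linear_cnj])
  have E': "((\<lambda>w. f (slice_pt e1 (cnj w))) has_derivative (\<lambda>h. E (cnj h))) (at z)"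
    using has_derivative_compose[OF cnj E(1)] by simp
  have "E (- \<i>) = - E \<i>"
    using E(1) has_derivative_linear linear_neg by blast
  then show ?thesis
    using D(2) E(2) unit_sphere_left_cancel[OF basis_in_unit_sphere(1)]
    by (intro that[of "\<lambda>h. (1/2) *\<^sub>R (D h + E (cnj h))"
          "\<lambda>h. (1/2) *\<^sub>R (e1 * (E (cnj h) - D h))"])
      (auto simp: stem_re_def[abs_def] stem_im_def[abs_def] algebra_simps
        intro!: derivative_eq_intros D(1) E')
qed

theorem representation_formula:
  assumes \<Omega>: "symmetric_slice_domain \<Omega>" and f: "slice_regular \<Omega> f"
    and J: "J \<in> \<S>" and z: "z \<in> slice_dom \<Omega>"
  shows "f (slice_pt J z) = stem_re f z + J * stem_im f z"
proof -
  obtain x where x: "complex_of_real x \<in> slice_dom \<Omega>"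
    using slice_dom_real_point[OF \<Omega>] .
  have "f (slice_pt J z) - (stem_re f z + J * stem_im f z) = 0"
  proof (rule slice_identity_principle[OF open_slice_dom[OF \<Omega>] connected_slice_dom[OF \<Omega>] x J _ _ z])
    fix w assume w: "w \<in> slice_dom \<Omega>"
    obtain D where D: "((\<lambda>w. f (slice_pt J w)) has_derivative D) (at w)" "D \<i> = J * D 1"
      using slice_regularD[OF \<Omega> f J w] .
    obtain A B where AB: "(stem_re f has_derivative A) (at w)" "(stem_im f has_derivative B) (at w)"
      "A \<i> = - B 1" "B \<i> = A 1"
      using stem_derivatives[OF \<Omega> f w] .
    \<comment> \<open>By the stem equations,
      \<open>A \<i> + J * B \<i> = J * (A 1 + J * B 1)\<close> for every unit J, not only for
      \<open>e1\<close>.\<close>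
    show "\<exists>D. ((\<lambda>a. f (slice_pt J a) - (stem_re f a + J * stem_im f a)) has_derivative D) (at w)
        \<and> D \<i> = J * D 1"
      using D(2) AB(3,4) unit_sphere_left_cancel[OF J]
      by (intro exI[of _ "\<lambda>h. D h - (A h + J * B h)"])
        (auto simp: algebra_simps intro!: derivative_eq_intros D(1) AB(1,2))
  next
    fix t
    \<comment> \<open>All slices share the real axis; conjugation is trivial there, so
      \<open>stem_re\<close> is f and \<open>stem_im\<close> vanishes.\<close>
    show "f (slice_pt J (of_real t)) -
        (stem_re f (of_real t) + J * stem_im f (of_real t)) = 0"
      by (simp add: stem_re_def stem_im_def slice_pt_def flip: scaleR_2)
  qed
  then show ?thesis by simp
qed

section \<open>Slice preserving functions\<close>

lemma slice_preserving_iff: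
  assumes "symmetric_slice_domain \<Omega>"
  shows "slice_preserving \<Omega> f \<longleftrightarrow> slice_regular \<Omega> f \<and>
    (\<forall>J\<in>\<S>. \<forall>z\<in>slice_dom \<Omega>. f (slice_pt J z) \<in> \<C> J)"
proof -
  have "\<Omega> \<inter> \<C> J = slice_pt J ` slice_dom \<Omega>" if "J \<in> \<S>" for J
    using slice_dom_iff[OF assms that] by (auto simp: slice_plane_eq_range)
  then show ?thesis
    unfolding slice_preserving_def by (simp add: image_subset_iff)
qed

lemma slice_preserving_const:
  assumes "symmetric_slice_domain \<Omega>"
  shows "slice_preserving \<Omega> (\<lambda>_. of_real r)"
  unfolding slice_preserving_iff[OF assms] slice_regular_iff[OF assms]
  by (auto simp: of_real_in_slice_plane intro!: exI[of _ "\<lambda>_. 0"])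

lemma slice_preserving_add:
  assumes \<Omega>: "symmetric_slice_domain \<Omega>" and "slice_preserving \<Omega> f" "slice_preserving \<Omega> g"
  shows "slice_preserving \<Omega> (\<lambda>q. f q + g q)"
proof -
  have "\<exists>D. ((\<lambda>w. f (slice_pt J w) + g (slice_pt J w)) has_derivative D) (at z) \<and> D \<i> = J * D 1"
    if J: "J \<in> \<S>" and z: "z \<in> slice_dom \<Omega>" for J z
  proof -
    obtain D where D: "((\<lambda>w. f (slice_pt J w)) has_derivative D) (at z)" "D \<i> = J * D 1"
      using slice_regularD[OF \<Omega> _ J z] assms(2) slice_preserving_def by metis
    obtain E where E: "((\<lambda>w. g (slice_pt J w)) has_derivative E) (at z)" "E \<i> = J * E 1"
      using slice_regularD[OF \<Omega> _ J z] assms(3) slice_preserving_def by metis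
    show ?thesis
      using has_derivative_add[OF D(1) E(1)] D(2) E(2) by (auto simp: distrib_left)
  qed
  then show ?thesis
    using assms(2,3) unfolding slice_preserving_iff[OF \<Omega>] slice_regular_iff[OF \<Omega>]
    by (auto intro: slice_plane_closed)
qed

text \<open>The Leibniz rule leaves J to the right of a value of f. This value lies in the plane of
  J, so J can be moved to the front.\<close>

lemma slice_preserving_mult:
  assumes \<Omega>: "symmetric_slice_domain \<Omega>" and "slice_preserving \<Omega> f" "slice_preserving \<Omega> g"
  shows "slice_preserving \<Omega> (\<lambda>q. f q * g q)"
proof -
  have "\<exists>D. ((\<lambda>w. f (slice_pt J w) * g (slice_pt J w)) has_derivative D) (at z) \<and> D \<i> = J * D 1"
    if J: "J \<in> \<S>" and z: "z \<in> slice_dom \<Omega>" for J z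
  proof -
    obtain D where D: "((\<lambda>w. f (slice_pt J w)) has_derivative D) (at z)" "D \<i> = J * D 1"
      using slice_regularD[OF \<Omega> _ J z] assms(2) slice_preserving_def by metis
    obtain E where E: "((\<lambda>w. g (slice_pt J w)) has_derivative E) (at z)" "E \<i> = J * E 1"
      using slice_regularD[OF \<Omega> _ J z] assms(3) slice_preserving_def by metis
    have "f (slice_pt J z) * J = J * f (slice_pt J z)"
      using assms(2) J z slice_plane_commute unit_in_slice_plane
      unfolding slice_preserving_iff[OF \<Omega>] by blast
    then have "f (slice_pt J z) * (J * E 1) = J * (f (slice_pt J z) * E 1)"
      by (metis mult.assoc)
    then show ?thesis
      using has_derivative_mult[OF D(1) E(1)] D(2) E(2)
      by (auto simp: distrib_left mult.assoc)
  qed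
  then show ?thesis
    using assms(2,3) unfolding slice_preserving_iff[OF \<Omega>] slice_regular_iff[OF \<Omega>]
    by (auto intro: slice_plane_mult)
qed

lemma slice_preserving_uminus:
  assumes "symmetric_slice_domain \<Omega>" "slice_preserving \<Omega> f"
  shows "slice_preserving \<Omega> (\<lambda>q. - f q)"
  using slice_preserving_mult[OF assms(1) slice_preserving_const[OF assms(1), of "-1"] assms(2)]
  by simp

lemma slice_preserving_diff:
  assumes "symmetric_slice_domain \<Omega>" "slice_preserving \<Omega> f" "slice_preserving \<Omega> g"
  shows "slice_preserving \<Omega> (\<lambda>q. f q - g q)"
  using slice_preserving_add[OF assms(1,2) slice_preserving_uminus[OF assms(1,3)]]
  by simp

lemmas slice_preserving_intros =
  slice_preserving_const slice_preserving_add slice_preserving_mult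
  slice_preserving_uminus slice_preserving_diff

text \<open>For each J, the values at z and \<open>cnj z\<close> lie in the plane of J and determine
  both stem parts there. As the stem parts are independent of J, they lie in all planes and are
  real.\<close>

lemma slice_preserving_stem_real:
  assumes \<Omega>: "symmetric_slice_domain \<Omega>" and f: "slice_preserving \<Omega> f" and z: "z \<in> slice_dom \<Omega>"
  obtains a b where "\<And>J. J \<in> \<S> \<Longrightarrow> f (slice_pt J z) = of_real a + J * of_real b"
proof -
  have reg: "slice_regular \<Omega> f" using f by (simp add: slice_preserving_def)
  have mem: "stem_re f z \<in> \<C> J \<and> stem_im f z \<in> \<C> J" if J: "J \<in> \<S>" for J
  proof -
    let ?p = "f (slice_pt J z)" and ?m = "f (slice_pt J (cnj z))"
    have p: "?p = stem_re f z + J * stem_im f z"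
      by (rule representation_formula[OF \<Omega> reg J z])
    have m: "?m = stem_re f z - J * stem_im f z"
      using representation_formula[OF \<Omega> reg J cnj_in_slice_dom[OF \<Omega> z]] by (simp add: stem_cnj)
    have "?p \<in> \<C> J" "?m \<in> \<C> J"
      using f J z cnj_in_slice_dom[OF \<Omega> z] by (simp_all add: slice_preserving_iff[OF \<Omega>])
    moreover have "stem_re f z = (1/2) *\<^sub>R (?p + ?m)"
      unfolding p m by (simp flip: scaleR_2)
    moreover have "stem_im f z = J * ((1/2) *\<^sub>R (?m - ?p))"
      unfolding p m using unit_sphere_left_cancel[OF J] by (simp add: algebra_simps flip: scaleR_2)
    ultimately show ?thesis
      using J by (metis slice_plane_closed(1,2,4) slice_plane_mult unit_in_slice_plane)
  qed
  then have "stem_re f z = of_real (q0 (stem_re f z))" "stem_im f z = of_real (q0 (stem_im f z))"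
    using slice_planes_Int_real by blast+
  then show ?thesis
    using that representation_formula[OF \<Omega> reg _ z] by metis
qed

text \<open>The function induced by a real stem pair, meant for \<open>a\<close> even and
  \<open>b\<close> odd under conjugation.\<close>

definition slice_fun :: "(complex \<Rightarrow> real) \<Rightarrow> (complex \<Rightarrow> real) \<Rightarrow> quat \<Rightarrow> quat" where
  "slice_fun a b q = of_real (a (quat_proj q)) + quat_dir q * of_real (b (quat_proj q))"

text \<open>On the real axis oddness makes \<open>b\<close> vanish. In the lower half plane the
  point is read as -J with \<open>cnj z\<close>, and the sign of \<open>b\<close> cancels that of
  J.\<close>

lemma slice_fun_slice_pt:
  assumes "\<And>z. a (cnj z) = a z" "\<And>z. b (cnj z) = - b z" "J \<in> \<S>"
  shows "slice_fun a b (slice_pt J z) = of_real (a z) + J * of_real (b z)"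
proof -
  consider "Im z = 0" | "Im z > 0" | "Im z < 0" by linarith
  then show ?thesis
  proof cases
    case 1
    then have z: "cnj z = z" "Complex (Re z) 0 = z" by (auto simp: complex_eq_iff)
    then have "b z = 0" using assms(2)[of z] by simp
    then show ?thesis using 1 z by (simp add: slice_fun_def quat_proj_slice_pt[OF assms(3)])
  next
    case 2
    then show ?thesis
      by (simp add: slice_fun_def quat_proj_slice_pt[OF assms(3)] quat_dir_slice_pt[OF assms(3)])
  next
    case 3
    then have "Complex (Re z) \<bar>Im z\<bar> = cnj z" by (simp add: complex_eq_iff)
    then show ?thesis using 3 assms(1,2)
      by (simp add: slice_fun_def quat_proj_slice_pt[OF assms(3)] quat_dir_slice_pt[OF assms(3)])
  qed
qed

text \<open>On each slice the function is a + J b: the Cauchy-Riemann equations give regularity, and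
  real values of \<open>a\<close> and \<open>b\<close> keep it in the plane of J.\<close>

lemma slice_preserving_slice_fun:
  assumes \<Omega>: "symmetric_slice_domain \<Omega>"
    and par: "\<And>z. a (cnj z) = a z" "\<And>z. b (cnj z) = - b z"
    and der: "\<And>z. z \<in> slice_dom \<Omega> \<Longrightarrow> \<exists>A B. (a has_derivative A) (at z) \<and>
      (b has_derivative B) (at z) \<and> A \<i> = - B 1 \<and> B \<i> = A 1"
  shows "slice_preserving \<Omega> (slice_fun a b)"
  unfolding slice_preserving_iff[OF \<Omega>] slice_regular_iff[OF \<Omega>]
proof (intro conjI ballI)
  note pt = slice_fun_slice_pt[where a = a and b = b, OF par]
  fix J z assume J: "J \<in> \<S>" and "z \<in> slice_dom \<Omega>"
  then obtain A B where AB: "(a has_derivative A) (at z)" "(b has_derivative B) (at z)"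
    "A \<i> = - B 1" "B \<i> = A 1"
    using der by blast
  then show "\<exists>D. ((\<lambda>w. slice_fun a b (slice_pt J w)) has_derivative D) (at z) \<and> D \<i> = J * D 1"
    unfolding pt[OF J] using unit_sphere_left_cancel[OF J]
    by (intro exI[of _ "\<lambda>h. of_real (A h) + J * of_real (B h)"])
      (auto simp: distrib_left intro!: derivative_eq_intros)
  show "slice_fun a b (slice_pt J z) \<in> \<C> J"
    unfolding pt[OF J] using J
    by (intro slice_plane_closed slice_plane_mult of_real_in_slice_plane unit_in_slice_plane)
qed

section \<open>The decomposition into slice preserving components\<close>

definition quat_coord :: "nat \<Rightarrow> quat \<Rightarrow> real" where
  "quat_coord l = (if l = 0 then q0 else if l = 1 then q1 else if l = 2 then q2 else q3)"

lemma bounded_linear_quat_coord: "bounded_linear (quat_coord l)"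
  by (simp add: quat_coord_def bounded_linear_quat_components)

text \<open>The predicate from which \<open>slice_comp\<close> chooses.\<close>

definition slice_decomp :: "quat set \<Rightarrow> (quat \<Rightarrow> quat) \<Rightarrow> (nat \<Rightarrow> quat \<Rightarrow> quat) \<Rightarrow> bool" where
  "slice_decomp \<Omega> f F \<longleftrightarrow> (\<forall>l\<le>3. slice_preserving \<Omega> (F l)) \<and>
     (\<forall>q\<in>\<Omega>. f q = F 0 q + F 1 q * e1 + F 2 q * e2 + F 3 q * e3)"

text \<open>Real coordinates of the stem parts inherit parity and the Cauchy-Riemann equations by
  linearity. The induced functions reassemble to A + J B because J multiplies on the left and the
  basis units on the right.\<close>

lemma slice_decomp_exists:
  assumes \<Omega>: "symmetric_slice_domain \<Omega>" and f: "slice_regular \<Omega> f"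
  shows "\<exists>F. slice_decomp \<Omega> f F"
proof -
  define a where "a l z = quat_coord l (stem_re f z)" for l z
  define b where "b l z = quat_coord l (stem_im f z)" for l z
  have lin: "linear (quat_coord l)" for l
    using bounded_linear.linear[OF bounded_linear_quat_coord] .
  have par: "a l (cnj z) = a l z" "b l (cnj z) = - b l z" for l z
    by (simp_all add: a_def b_def stem_cnj linear_neg[OF lin])
  have "slice_preserving \<Omega> (slice_fun (a l) (b l))" for l
  proof (rule slice_preserving_slice_fun[where a = "a l" and b = "b l", OF \<Omega> par])
    fix z assume z: "z \<in> slice_dom \<Omega>"
    obtain A B where AB: "(stem_re f has_derivative A) (at z)" "(stem_im f has_derivative B) (at z)"
      "A \<i> = - B 1" "B \<i> = A 1"
      using stem_derivatives[OF \<Omega> f z] .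
    then show "\<exists>A B. (a l has_derivative A) (at z) \<and> (b l has_derivative B) (at z) \<and>
        A \<i> = - B 1 \<and> B \<i> = A 1"
      unfolding a_def[abs_def] b_def[abs_def]
      by (intro exI[of _ "\<lambda>h. quat_coord l (A h)"] exI[of _ "\<lambda>h. quat_coord l (B h)"] conjI
          bounded_linear.has_derivative[OF bounded_linear_quat_coord])
        (simp_all add: linear_neg[OF lin])
  qed
  moreover have "f q = slice_fun (a 0) (b 0) q + slice_fun (a 1) (b 1) q * e1
      + slice_fun (a 2) (b 2) q * e2 + slice_fun (a 3) (b 3) q * e3" if "q \<in> \<Omega>" for q
  proof -
    define J z where "J = quat_dir q" and "z = quat_proj q"
    have q: "q = slice_pt J z" and J: "J \<in> \<S>"
      by (simp_all add: J_def z_def slice_pt_quat_proj quat_dir_in_unit_sphere)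
    then have "z \<in> slice_dom \<Omega>" using slice_dom_iff[OF \<Omega> J] that by simp
    then have "f q = stem_re f z + J * stem_im f z"
      unfolding q by (rule representation_formula[OF \<Omega> f J])
    then show ?thesis
      unfolding q slice_fun_slice_pt[where a = "a l" and b = "b l" for l, OF par J]
      by (simp add: a_def b_def quat_coord_def quat_eq_iff)
  qed
  ultimately show ?thesis
    unfolding slice_decomp_def by (intro exI[of _ "\<lambda>l. slice_fun (a l) (b l)"]) blast
qed

lemma quat_real_expansion_zero:
  assumes "of_real a0 + of_real a1 * e1 + of_real a2 * e2 + of_real a3 * e3 = 0"
  shows "a0 = 0" "a1 = 0" "a2 = 0" "a3 = 0"
  using assms by (simp_all add: quat_eq_iff)

text \<open>
  On one slice the decomposition is not unique (\<open>e1\<close> itself lies in the slice plane of \<open>e1\<close>);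
  comparing the antipodal units \<open>J\<close> and \<open>- J\<close> forces both stem parts to vanish.
\<close>

lemma slice_decomp_zero:
  assumes \<Omega>: "symmetric_slice_domain \<Omega>" and F: "slice_decomp \<Omega> (\<lambda>_. 0) F"
    and l: "l \<le> 3" and q: "q \<in> \<Omega>"
  shows "F l q = 0"
proof -
  define J z where "J = quat_dir q" and "z = quat_proj q"
  have qz: "q = slice_pt J z" and J: "J \<in> \<S>"
    by (simp_all add: J_def z_def slice_pt_quat_proj quat_dir_in_unit_sphere)
  have z: "z \<in> slice_dom \<Omega>" using slice_dom_iff[OF \<Omega> J] q qz by simp
  have "\<forall>l. \<exists>a b. l \<le> 3 \<longrightarrow> (\<forall>J\<in>\<S>. F l (slice_pt J z) = of_real a + J * of_real b)"
    using slice_preserving_stem_real[OF \<Omega> _ z] F unfolding slice_decomp_def by metis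
  then obtain a b where
    ab: "\<And>l J. l \<le> 3 \<Longrightarrow> J \<in> \<S> \<Longrightarrow> F l (slice_pt J z) = of_real (a l) + J * of_real (b l)"
    by metis
  define A where "A = of_real (a 0) + of_real (a 1) * e1 + of_real (a 2) * e2 + of_real (a 3) * e3"
  define B where "B = of_real (b 0) + of_real (b 1) * e1 + of_real (b 2) * e2 + of_real (b 3) * e3"
  \<comment> \<open>The reals \<open>a l\<close> and \<open>b l\<close> are common to all units, so
    this holds for J and \<open>- J\<close> alike.\<close>
  have eq: "A + J * B = 0" if "J \<in> \<S>" for J
  proof -
    have "slice_pt J z \<in> \<Omega>" using slice_dom_iff[OF \<Omega> that] z by simp
    then have "0 = F 0 (slice_pt J z) + F 1 (slice_pt J z) * e1
        + F 2 (slice_pt J z) * e2 + F 3 (slice_pt J z) * e3"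
      using F unfolding slice_decomp_def by blast
    then show ?thesis using ab that by (simp add: A_def B_def algebra_simps)
  qed
  have "J * B = - A" "J * B = A"
    using eq[OF J] eq[OF unit_sphere_uminus[OF J]] by (simp_all add: add_eq_0_iff)
  then have "2 *\<^sub>R A = 0" by (metis scaleR_2 add.right_inverse)
  then have A: "A = 0" by simp
  with \<open>J * B = A\<close> have B: "B = 0" using unit_sphere_left_cancel[OF J, of B] by auto
  have "l = 0 \<or> l = 1 \<or> l = 2 \<or> l = 3" using l by linarith
  then have "a l = 0" "b l = 0"
    using quat_real_expansion_zero[OF A[unfolded A_def]]
      quat_real_expansion_zero[OF B[unfolded B_def]] by auto
  then show ?thesis using ab[OF l J] qz by simp
qed

lemma slice_decomp_slice_comp:
  assumes "slice_decomp \<Omega> f F"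
  shows "slice_decomp \<Omega> f (slice_comp \<Omega> f)"
proof -
  have "slice_comp \<Omega> f = (SOME F. slice_decomp \<Omega> f F)"
    by (simp add: slice_comp_def slice_decomp_def)
  then show ?thesis using someI[of "slice_decomp \<Omega> f"] assms by simp
qed

text \<open>The difference of two decompositions of f decomposes 0.\<close>

lemma slice_comp_eq:
  assumes \<Omega>: "symmetric_slice_domain \<Omega>" and F: "slice_decomp \<Omega> f F"
    and l: "l \<le> 3" and q: "q \<in> \<Omega>"
  shows "slice_comp \<Omega> f l q = F l q"
proof -
  have G: "slice_decomp \<Omega> f (slice_comp \<Omega> f)"
    by (rule slice_decomp_slice_comp[OF F])
  have "slice_decomp \<Omega> (\<lambda>_. 0) (\<lambda>l q. slice_comp \<Omega> f l q - F l q)"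
    unfolding slice_decomp_def
  proof (intro conjI ballI allI impI)
    fix q assume q: "q \<in> \<Omega>"
    have "f q = slice_comp \<Omega> f 0 q + slice_comp \<Omega> f 1 q * e1
      + slice_comp \<Omega> f 2 q * e2 + slice_comp \<Omega> f 3 q * e3"
      "f q = F 0 q + F 1 q * e1 + F 2 q * e2 + F 3 q * e3"
      using F G q unfolding slice_decomp_def by blast+
    then show "0 = slice_comp \<Omega> f 0 q - F 0 q + (slice_comp \<Omega> f 1 q - F 1 q) * e1
      + (slice_comp \<Omega> f 2 q - F 2 q) * e2 + (slice_comp \<Omega> f 3 q - F 3 q) * e3"
      by (simp add: algebra_simps)
  qed (use F G in \<open>auto simp: slice_decomp_def intro: slice_preserving_diff[OF \<Omega>]\<close>)
  then show ?thesis using slice_decomp_zero[OF \<Omega> _ l q] by fastforce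
qed

text \<open>Packs explicit components into an indexed family; indices above 3 repeat the last
  one.\<close>

definition four :: "'a \<Rightarrow> 'a \<Rightarrow> 'a \<Rightarrow> 'a \<Rightarrow> nat \<Rightarrow> 'a" where
  "four w x y z l = (if l = 0 then w else if l = 1 then x else if l = 2 then y else z)"

lemma slice_decomp_four:
  assumes "slice_preserving \<Omega> w" "slice_preserving \<Omega> x" "slice_preserving \<Omega> y" "slice_preserving \<Omega> z"
    and "\<And>q. q \<in> \<Omega> \<Longrightarrow> f q = w q + x q * e1 + y q * e2 + z q * e3"
  shows "slice_decomp \<Omega> f (four w x y z)"
  using assms by (auto simp: slice_decomp_def four_def)

text \<open>Turns an explicit decomposition into rewrite rules for the chosen components.\<close>

lemma slice_comp_four:
  assumes \<Omega>: "symmetric_slice_domain \<Omega>"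
    and F: "slice_decomp \<Omega> f (four w x y z)"
    and q: "q \<in> \<Omega>"
  shows "slice_comp \<Omega> f 0 q = w q" "slice_comp \<Omega> f 1 q = x q"
    "slice_comp \<Omega> f 2 q = y q" "slice_comp \<Omega> f 3 q = z q"
  using slice_comp_eq[OF \<Omega> F _ q] by (simp_all add: four_def)

section \<open>Components of constants, conjugates and star products\<close>

lemma slice_decomp_const:
  assumes "symmetric_slice_domain \<Omega>"
  shows "slice_decomp \<Omega> (\<lambda>_. c) (four (\<lambda>_. of_real (q0 c)) (\<lambda>_. of_real (q1 c))
    (\<lambda>_. of_real (q2 c)) (\<lambda>_. of_real (q3 c)))"
  by (rule slice_decomp_four) (simp_all add: slice_preserving_const[OF assms] quat_eq_iff)

lemma slice_decomp_regular_conj: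
  assumes "symmetric_slice_domain \<Omega>" "slice_decomp \<Omega> g G"
  defines "g' \<equiv> slice_comp \<Omega> g"
  shows "slice_decomp \<Omega> (regular_conj \<Omega> g)
    (four (g' 0) (\<lambda>q. - g' 1 q) (\<lambda>q. - g' 2 q) (\<lambda>q. - g' 3 q))"
  using slice_decomp_slice_comp[OF assms(2)] unfolding g'_def
  by (intro slice_decomp_four slice_preserving_uminus[OF assms(1)])
    (simp_all add: slice_decomp_def regular_conj_def)

text \<open>The defining formula is regrouped by basis unit without commuting factors; each
  coefficient is built from slice preserving functions by sums, differences and products.\<close>

lemma slice_decomp_star_prod:
  assumes \<Omega>: "symmetric_slice_domain \<Omega>" and f: "slice_decomp \<Omega> f F" and g: "slice_decomp \<Omega> g G"
  defines "f' \<equiv> slice_comp \<Omega> f" and "g' \<equiv> slice_comp \<Omega> g"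
  shows "slice_decomp \<Omega> (star_prod \<Omega> f g) (four
    (\<lambda>q. f' 0 q * g' 0 q - f' 1 q * g' 1 q - f' 2 q * g' 2 q - f' 3 q * g' 3 q)
    (\<lambda>q. f' 0 q * g' 1 q + g' 0 q * f' 1 q + f' 2 q * g' 3 q - f' 3 q * g' 2 q)
    (\<lambda>q. f' 0 q * g' 2 q + g' 0 q * f' 2 q + f' 3 q * g' 1 q - f' 1 q * g' 3 q)
    (\<lambda>q. f' 0 q * g' 3 q + g' 0 q * f' 3 q + f' 1 q * g' 2 q - f' 2 q * g' 1 q))"
  using slice_decomp_slice_comp[OF f] slice_decomp_slice_comp[OF g] unfolding f'_def g'_def
  by (intro slice_decomp_four slice_preserving_intros[OF \<Omega>])
    (simp_all add: slice_decomp_def star_prod_def Let_def algebra_simps)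

section \<open>Orthonormal bases of the imaginary quaternions\<close>

lemma ImH_q0: "x \<in> ImH \<Longrightarrow> q0 x = 0"
  unfolding ImH_def by (induction rule: span_induct_alt) auto

lemma orthonormal_basis_ImH_expansion:
  assumes "orthonormal_basis_ImH i j k" and x: "x \<in> ImH"
  shows "x = inner x i *\<^sub>R i + inner x j *\<^sub>R j + inner x k *\<^sub>R k"
proof -
  have "x \<in> span {i, j, k}" using assms by (simp add: orthonormal_basis_ImH_def)
  then obtain a b c where "x - a *\<^sub>R i - b *\<^sub>R j = c *\<^sub>R k"
    by (auto simp: span_insert)
  then have x: "x = a *\<^sub>R i + b *\<^sub>R j + c *\<^sub>R k" by (simp add: algebra_simps)
  have "inner i i = 1" "inner j j = 1" "inner k k = 1" "inner i j = 0" "inner i k = 0" "inner j k = 0"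
    "inner j i = 0" "inner k i = 0" "inner k j = 0"
    using assms by (simp_all add: orthonormal_basis_ImH_def dot_square_norm inner_commute)
  then show ?thesis
    unfolding x by (simp add: inner_add_left)
qed

text \<open>The coordinate \<open>q1 i\<close> is the inner product of \<open>i\<close> with
  \<open>e1\<close>, so these are the expansions of the standard units in the new basis.\<close>

lemma orthonormal_basis_ImH_units:
  assumes "orthonormal_basis_ImH i j k"
  shows "q1 i *\<^sub>R i + q1 j *\<^sub>R j + q1 k *\<^sub>R k = e1" "q2 i *\<^sub>R i + q2 j *\<^sub>R j + q2 k *\<^sub>R k = e2"
    "q3 i *\<^sub>R i + q3 j *\<^sub>R j + q3 k *\<^sub>R k = e3"
proof -
  have "e1 \<in> ImH" "e2 \<in> ImH" "e3 \<in> ImH" by (simp_all add: ImH_def span_base)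
  then show "q1 i *\<^sub>R i + q1 j *\<^sub>R j + q1 k *\<^sub>R k = e1" "q2 i *\<^sub>R i + q2 j *\<^sub>R j + q2 k *\<^sub>R k = e2"
    "q3 i *\<^sub>R i + q3 j *\<^sub>R j + q3 k *\<^sub>R k = e3"
    using orthonormal_basis_ImH_expansion[OF assms]
    by (simp_all add: quat_components_eq_inner(2-4) inner_commute)
qed

text \<open>Since u^c = -u, the left side is morally the real part of -(f * g^c) * u. The proof
  compares both sides as polynomials in the components of f and g.\<close>

lemma star_inner_imaginary_mult:
  assumes \<Omega>: "symmetric_slice_domain \<Omega>" and f: "slice_regular \<Omega> f" and g: "slice_regular \<Omega> g"
    and u: "q0 u = 0" and q: "q \<in> \<Omega>"
  defines "h \<equiv> slice_comp \<Omega> (star_hermitian \<Omega> f g)"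
  shows "star_inner \<Omega> f (star_prod \<Omega> (\<lambda>_. u) g) q = q1 u *\<^sub>R h 1 q + q2 u *\<^sub>R h 2 q + q3 u *\<^sub>R h 3 q"
proof -
  obtain F G where F: "slice_decomp \<Omega> f F" and G: "slice_decomp \<Omega> g G"
    using slice_decomp_exists[OF \<Omega>] f g by blast
  \<comment> \<open>One decomposition for each nested \<open>slice_comp\<close>: u, u * g, its
    conjugate and the product with f, then g^c and f * g^c.\<close>
  note C = slice_decomp_const[OF \<Omega>, of u]
  note UG = slice_decomp_star_prod[OF \<Omega> C G]
  note cUG = slice_decomp_regular_conj[OF \<Omega> UG]
  note P = slice_decomp_star_prod[OF \<Omega> F cUG]
  note cG = slice_decomp_regular_conj[OF \<Omega> G]
  note H = slice_decomp_star_prod[OF \<Omega> F cG]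
  define J where "J = quat_dir q"
  \<comment> \<open>At q all components take values in the one slice plane through q.\<close>
  have comm: "slice_comp \<Omega> f m q * slice_comp \<Omega> g n q = slice_comp \<Omega> g n q * slice_comp \<Omega> f m q"
    if "m \<le> 3" "n \<le> 3" for m n
  proof -
    have "q \<in> \<Omega> \<inter> \<C> J" "J \<in> \<S>"
      using q slice_pt_in_slice_plane[of J "quat_proj q"]
      by (simp_all add: J_def slice_pt_quat_proj quat_dir_in_unit_sphere)
    moreover have "slice_preserving \<Omega> (slice_comp \<Omega> f m)" "slice_preserving \<Omega> (slice_comp \<Omega> g n)"
      using slice_decomp_slice_comp[OF F] slice_decomp_slice_comp[OF G] that
      by (simp_all add: slice_decomp_def)
    ultimately have "slice_comp \<Omega> f m q \<in> \<C> J" "slice_comp \<Omega> g n q \<in> \<C> J"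
      unfolding slice_preserving_def by blast+
    then show ?thesis by (rule slice_plane_commute)
  qed
  have s: "of_real r * x = r *\<^sub>R x" "x * of_real r = r *\<^sub>R x" for r and x :: quat
    by (simp_all add: of_real_def)
  show ?thesis
    unfolding h_def star_inner_def star_hermitian_def slice_real_part_def
      slice_comp_four[OF \<Omega> P q] slice_comp_four[OF \<Omega> cUG q] slice_comp_four[OF \<Omega> UG q]
      slice_comp_four[OF \<Omega> C q] slice_comp_four[OF \<Omega> H q] slice_comp_four[OF \<Omega> cG q]
    using u by (simp add: s comm algebra_simps)
qed

theorem proposition2p2:
  fixes \<Omega> :: "quat set" and f g :: "quat \<Rightarrow> quat" and i j k :: quat
  assumes "symmetric_slice_domain \<Omega>"
    and "slice_regular \<Omega> f" and "slice_regular \<Omega> g"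
    and "orthonormal_basis_ImH i j k"
  shows "\<forall>q\<in>\<Omega>. star_hermitian \<Omega> f g q =
    star_inner \<Omega> f g q
    + star_inner \<Omega> f (star_prod \<Omega> (\<lambda>_. i) g) q * i
    + star_inner \<Omega> f (star_prod \<Omega> (\<lambda>_. j) g) q * j
    + star_inner \<Omega> f (star_prod \<Omega> (\<lambda>_. k) g) q * k"
proof
  fix q assume q: "q \<in> \<Omega>"
  define h where "h = slice_comp \<Omega> (star_hermitian \<Omega> f g)"
  obtain F G where F: "slice_decomp \<Omega> f F" and G: "slice_decomp \<Omega> g G"
    using slice_decomp_exists[OF assms(1)] assms(2,3) by blast
  have "\<exists>H. slice_decomp \<Omega> (star_hermitian \<Omega> f g) H"
    unfolding star_hermitian_def
    using slice_decomp_star_prod[OF assms(1) F slice_decomp_regular_conj[OF assms(1) G]] by blast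
  then have "slice_decomp \<Omega> (star_hermitian \<Omega> f g) h"
    unfolding h_def using slice_decomp_slice_comp by blast
  then have "star_hermitian \<Omega> f g q = h 0 q + h 1 q * e1 + h 2 q * e2 + h 3 q * e3"
    using q by (simp add: slice_decomp_def)
  also have "h 0 q = star_inner \<Omega> f g q"
    by (simp add: h_def star_hermitian_def star_inner_def slice_real_part_def)
  finally have herm: "star_hermitian \<Omega> f g q =
      star_inner \<Omega> f g q + h 1 q * e1 + h 2 q * e2 + h 3 q * e3" .
  have "i \<in> ImH" "j \<in> ImH" "k \<in> ImH"
    using assms(4) span_base[of _ "{i, j, k}"] by (simp_all add: orthonormal_basis_ImH_def)
  then have "q0 i = 0" "q0 j = 0" "q0 k = 0" by (simp_all add: ImH_q0)
  then have inner: "star_inner \<Omega> f (star_prod \<Omega> (\<lambda>_. u) g) q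
      = q1 u *\<^sub>R h 1 q + q2 u *\<^sub>R h 2 q + q3 u *\<^sub>R h 3 q" if "u \<in> {i, j, k}" for u
    using star_inner_imaginary_mult[OF assms(1-3) _ q] that unfolding h_def by blast
  \<comment> \<open>With the standard units expanded, the coefficient of \<open>i\<close> is
    \<open>q1 i *\<^sub>R h 1 q + q2 i *\<^sub>R h 2 q + q3 i *\<^sub>R h 3 q\<close>, which is
    \<open>inner\<close> at \<open>u = i\<close>; likewise for \<open>j\<close> and
    \<open>k\<close>.\<close>
  show "star_hermitian \<Omega> f g q =
    star_inner \<Omega> f g q
    + star_inner \<Omega> f (star_prod \<Omega> (\<lambda>_. i) g) q * i
    + star_inner \<Omega> f (star_prod \<Omega> (\<lambda>_. j) g) q * j
    + star_inner \<Omega> f (star_prod \<Omega> (\<lambda>_. k) g) q * k"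
    unfolding herm orthonormal_basis_ImH_units[OF assms(4), symmetric]
    by (simp add: inner algebra_simps)
qed

end
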